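(* Let $k=\mathbf{C}$ and let $n$ be a positive integer. Define $$A_0=k\langle\langle a,b\rangle\rangle/(ab+ba,\;a^2+b^{2n+1}),\qquad A_i=k\langle\langle a,b\rangle\rangle/(ab+ba,\;a^2+b^{2n+1}+b^{2i})\quad(1\le i\le 2n),$$ and let $A_i^{ab}=A_i/([A_i,A_i])$ denote their abelianizations. Then $A_0^{ab},A_1^{ab},\dots,A_n^{ab}$ are not isomorphic to each other, while $A_0^{ab},A_{n+1}^{ab},\dots,A_{2n}^{ab}$ are isomorphic.
   Context: $k\langle\langle a,b\rangle\rangle$ is the non-commutative formal power series ring in two variables, and $(\cdots)$ denotes the two-sided ideal generated by the listed elements; $([A_i,A_i])$ is the two-sided ideal generated by all commutators. Isomorphisms are isomorphisms of $k$-algebras. *)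

theory Defs
  imports Complex_Main "HOL-Algebra.QuotRing" "HOL-Algebra.Module"
begin

section \<open>Non-commutative formal power series\<close>

text \<open>
  A non-commutative formal power series over \<open>'k\<close> in the variables \<open>'x\<close> is the family of its
  coefficients, indexed by the words in \<open>'x\<close>.  The record type \<^type>\<open>module\<close> serves for
  \<open>'k\<close>-algebras: it carries a ring structure together with a scalar multiplication.  (The locale
  \<^locale>\<open>algebra\<close> is not used, since it requires the multiplication to be commutative.)
\<close>

definition nc_mult ::
    "('x list \<Rightarrow> 'k::field) \<Rightarrow> ('x list \<Rightarrow> 'k) \<Rightarrow> 'x list \<Rightarrow> 'k" where
  "nc_mult f g w = (\<Sum>i\<le>length w. f (take i w) * g (drop i w))"

definition NCPS :: "('k::field, 'x list \<Rightarrow> 'k) module" where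
  "NCPS = \<lparr>carrier = UNIV, mult = nc_mult, one = (\<lambda>w. if w = [] then 1 else 0),
           zero = (\<lambda>w. 0), add = (\<lambda>f g w. f w + g w), smult = (\<lambda>c f w. c * f w)\<rparr>"

definition nc_var :: "'x \<Rightarrow> 'x list \<Rightarrow> 'k::field" where
  "nc_var x = (\<lambda>w. if w = [x] then 1 else 0)"

lemma nc_mult_Nil: "nc_mult f g [] = f [] * g []"
  by (simp add: nc_mult_def)

lemma nc_mult_Cons:
  "nc_mult f g (x # w) = f [] * g (x # w) + nc_mult (\<lambda>v. f (x # v)) g w"
  by (simp add: nc_mult_def sum.atMost_Suc_shift del: sum.atMost_Suc)

lemma nc_mult_add_left:
  "nc_mult (\<lambda>w. f w + g w) h w = nc_mult f h w + nc_mult g h w"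
  by (simp add: nc_mult_def distrib_right sum.distrib)

lemma nc_mult_add_right:
  "nc_mult h (\<lambda>w. f w + g w) w = nc_mult h f w + nc_mult h g w"
  by (simp add: nc_mult_def distrib_left sum.distrib)

lemma nc_mult_scale_left: "nc_mult (\<lambda>w. c * f w) g w = c * nc_mult f g w"
  by (simp add: nc_mult_def sum_distrib_left mult.assoc)

lemma nc_mult_scale_right: "nc_mult f (\<lambda>w. c * g w) w = c * nc_mult f g w"
  by (simp add: nc_mult_def sum_distrib_left mult.left_commute)

lemma nc_mult_assoc: "nc_mult (nc_mult f g) h w = nc_mult f (nc_mult g h) w"
proof (induction w arbitrary: f)
  case Nil
  show ?case by (simp add: nc_mult_Nil mult.assoc)
next
  case (Cons x w)
  show ?case
    by (simp add: nc_mult_Nil nc_mult_Cons nc_mult_add_left nc_mult_scale_left Cons.IH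
        distrib_left mult.assoc)
qed

lemma nc_mult_zero_left: "nc_mult (\<lambda>w. 0) f w = 0"
  by (simp add: nc_mult_def)

lemma nc_mult_one_left: "nc_mult (\<lambda>w. if w = [] then 1 else 0) f w = f w"
  by (cases w) (simp_all add: nc_mult_Nil nc_mult_Cons nc_mult_zero_left)

lemma nc_mult_one_right: "nc_mult f (\<lambda>w. if w = [] then 1 else 0) w = f w"
  by (induction w arbitrary: f) (simp_all add: nc_mult_Nil nc_mult_Cons)

lemma ring_NCPS: "ring (NCPS :: ('k::field, 'x list \<Rightarrow> 'k) module)"
proof (rule ringI)
  show "abelian_group (NCPS :: ('k, 'x list \<Rightarrow> 'k) module)"
  proof (rule abelian_groupI)
    fix f :: "'x list \<Rightarrow> 'k"
    show "\<exists>g\<in>carrier NCPS. g \<oplus>\<^bsub>NCPS\<^esub> f = \<zero>\<^bsub>NCPS\<^esub>"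
      by (rule bexI[of _ "\<lambda>w. - f w"]) (auto simp: NCPS_def)
  qed (auto simp: NCPS_def algebra_simps)
  show "monoid (NCPS :: ('k, 'x list \<Rightarrow> 'k) module)"
    by (rule monoidI) (auto simp: NCPS_def nc_mult_assoc nc_mult_one_left nc_mult_one_right)
qed (auto simp: NCPS_def nc_mult_add_left nc_mult_add_right)


section \<open>Quotients, abelianizations and isomorphisms of algebras\<close>

text \<open>The scalar multiplication on cosets follows the pattern of \<^const>\<open>rcoset_mult\<close>.\<close>

definition alg_quot :: "('k, 'a, 'm) module_scheme \<Rightarrow> 'a set \<Rightarrow> ('k, 'a set) module" where
  "alg_quot M I =
    \<lparr>carrier = carrier (M Quot I), mult = mult (M Quot I), one = one (M Quot I),
     zero = zero (M Quot I), add = add (M Quot I),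
     smult = (\<lambda>c X. \<Union>x\<in>X. I +>\<^bsub>M\<^esub> (c \<odot>\<^bsub>M\<^esub> x))\<rparr>"

definition abelianization :: "('k, 'a, 'm) module_scheme \<Rightarrow> ('k, 'a set) module" where
  "abelianization M = alg_quot M
    (genideal M {(x \<otimes>\<^bsub>M\<^esub> y) \<ominus>\<^bsub>M\<^esub> (y \<otimes>\<^bsub>M\<^esub> x) | x y. x \<in> carrier M \<and> y \<in> carrier M})"

text \<open>Scalars range over the whole type \<open>'k\<close>, which plays the role of the ground field.\<close>

definition alg_iso ::
    "('k, 'a, 'm) module_scheme \<Rightarrow> ('k, 'b, 'n) module_scheme \<Rightarrow> ('a \<Rightarrow> 'b) set" where
  "alg_iso M N =
    {\<phi> \<in> ring_iso M N. \<forall>c. \<forall>x\<in>carrier M. \<phi> (c \<odot>\<^bsub>M\<^esub> x) = c \<odot>\<^bsub>N\<^esub> \<phi> x}"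

definition alg_isomorphic ::
    "('k, 'a, 'm) module_scheme \<Rightarrow> ('k, 'b, 'n) module_scheme \<Rightarrow> bool" where
  "alg_isomorphic M N \<longleftrightarrow> alg_iso M N \<noteq> {}"

lemma alg_quot_ring:
  assumes "ideal I M"
  shows "ring (alg_quot M I)"
proof -
  interpret Q: ring "M Quot I" using assms by (rule ideal.quotient_is_ring)
  show ?thesis
  proof (rule ringI)
    show "abelian_group (alg_quot M I)"
    proof (rule abelian_groupI)
      fix X assume "X \<in> carrier (alg_quot M I)"
      then show "\<exists>Y\<in>carrier (alg_quot M I).
          Y \<oplus>\<^bsub>alg_quot M I\<^esub> X = \<zero>\<^bsub>alg_quot M I\<^esub>"
        by (intro bexI[of _ "\<ominus>\<^bsub>M Quot I\<^esub> X"]) (simp_all add: alg_quot_def Q.l_neg)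
    next
      fix X Y Z assume "X \<in> carrier (alg_quot M I)" "Y \<in> carrier (alg_quot M I)"
        "Z \<in> carrier (alg_quot M I)"
      then show "X \<oplus>\<^bsub>alg_quot M I\<^esub> Y \<oplus>\<^bsub>alg_quot M I\<^esub> Z =
          X \<oplus>\<^bsub>alg_quot M I\<^esub> (Y \<oplus>\<^bsub>alg_quot M I\<^esub> Z)"
        by (simp add: alg_quot_def Q.a_assoc)
    next
      fix X Y assume "X \<in> carrier (alg_quot M I)" "Y \<in> carrier (alg_quot M I)"
      then show "X \<oplus>\<^bsub>alg_quot M I\<^esub> Y = Y \<oplus>\<^bsub>alg_quot M I\<^esub> X"
        using Q.a_comm by (simp add: alg_quot_def)
    qed (simp_all add: alg_quot_def)
    show "monoid (alg_quot M I)"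
      using Q.m_assoc by (intro monoidI) (auto simp: alg_quot_def)
  qed (auto simp: alg_quot_def Q.l_distr Q.r_distr)
qed

text \<open>
  Scalar multiplication on the quotient is induced by the one on representatives whenever the
  ideal is closed under scalars, as is every ideal of an algebra.
\<close>

lemma alg_quot_smult:
  assumes I: "ideal I M" and x: "x \<in> carrier M"
    and closed: "\<And>y. y \<in> carrier M \<Longrightarrow> c \<odot>\<^bsub>M\<^esub> y \<in> carrier M"
    and distr: "\<And>y z. y \<in> carrier M \<Longrightarrow> z \<in> carrier M \<Longrightarrow>
        c \<odot>\<^bsub>M\<^esub> (y \<oplus>\<^bsub>M\<^esub> z) = c \<odot>\<^bsub>M\<^esub> y \<oplus>\<^bsub>M\<^esub> c \<odot>\<^bsub>M\<^esub> z"
    and I_smult: "\<And>y. y \<in> I \<Longrightarrow> c \<odot>\<^bsub>M\<^esub> y \<in> I"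
  shows "c \<odot>\<^bsub>alg_quot M I\<^esub> (I +>\<^bsub>M\<^esub> x) = I +>\<^bsub>M\<^esub> (c \<odot>\<^bsub>M\<^esub> x)"
proof -
  interpret ideal I M by (rule I)
  have eq: "I +>\<^bsub>M\<^esub> (c \<odot>\<^bsub>M\<^esub> y) = I +>\<^bsub>M\<^esub> (c \<odot>\<^bsub>M\<^esub> x)" if "y \<in> I +>\<^bsub>M\<^esub> x" for y
  proof -
    from that obtain h where h: "h \<in> I" "y = h \<oplus>\<^bsub>M\<^esub> x"
      by (auto simp: a_r_coset_def')
    then have "c \<odot>\<^bsub>M\<^esub> y \<in> I +>\<^bsub>M\<^esub> (c \<odot>\<^bsub>M\<^esub> x)"
      using x by (auto simp: a_r_coset_def' distr I_smult a_Hcarr)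
    then show ?thesis
      using a_repr_independence[OF _ closed[OF x] a_subgroup] by simp
  qed
  moreover have "x \<in> I +>\<^bsub>M\<^esub> x" using x by (rule a_rcos_self)
  ultimately have "(\<Union>y\<in>I +>\<^bsub>M\<^esub> x. I +>\<^bsub>M\<^esub> (c \<odot>\<^bsub>M\<^esub> y)) = I +>\<^bsub>M\<^esub> (c \<odot>\<^bsub>M\<^esub> x)"
    by blast
  then show ?thesis unfolding alg_quot_def by simp
qed


section \<open>The algebras under consideration\<close>

datatype letter = Letter_a | Letter_b

abbreviation Cab :: "(complex, letter list \<Rightarrow> complex) module" where
  "Cab \<equiv> NCPS"

abbreviation var_a :: "letter list \<Rightarrow> complex" where
  "var_a \<equiv> nc_var Letter_a"

abbreviation var_b :: "letter list \<Rightarrow> complex" where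
  "var_b \<equiv> nc_var Letter_b"

definition relations :: "nat \<Rightarrow> nat \<Rightarrow> (letter list \<Rightarrow> complex) set" where
  "relations n i =
    {var_a \<otimes>\<^bsub>Cab\<^esub> var_b \<oplus>\<^bsub>Cab\<^esub> var_b \<otimes>\<^bsub>Cab\<^esub> var_a,
     if i = 0
     then var_a [^]\<^bsub>Cab\<^esub> (2::nat) \<oplus>\<^bsub>Cab\<^esub> var_b [^]\<^bsub>Cab\<^esub> (2 * n + 1)
     else var_a [^]\<^bsub>Cab\<^esub> (2::nat) \<oplus>\<^bsub>Cab\<^esub> var_b [^]\<^bsub>Cab\<^esub> (2 * n + 1)
            \<oplus>\<^bsub>Cab\<^esub> var_b [^]\<^bsub>Cab\<^esub> (2 * i)}"

text \<open>
  Ideals are two-sided and purely algebraic: no closure with respect to the topology of the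
  power series ring is taken.
\<close>

definition A :: "nat \<Rightarrow> nat \<Rightarrow> (complex, (letter list \<Rightarrow> complex) set) module" where
  "A n i = alg_quot Cab (genideal Cab (relations n i))"

end

theory Submission
  imports Defs
begin

text \<open>
  In the abelianization of \<open>A n i\<close> the relation \<open>ab + ba = 0\<close> becomes \<open>ab = 0\<close>.  Let \<open>d\<close> be the
  lowest exponent of \<open>b\<close> in the second relation.  Multiplying that relation by \<open>b\<close> gives
  \<open>b\<^sup>d\<^sup>+\<^sup>1 = 0\<close> if \<open>i = 0\<close>, and \<open>b\<^sup>d\<^sup>+\<^sup>1 (1 + b\<^sup>e) = 0\<close> otherwise, where \<open>d + e\<close> is the other
  exponent.  The second factor is a unit, so \<open>b\<^sup>d\<^sup>+\<^sup>1 = 0\<close> in all cases, the higher power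
  of \<open>b\<close> disappears from the relation, and what is left is the finite-dimensional local algebra
  \<open>k[[a,b]]/(ab, a\<^sup>2 + b\<^sup>d)\<close>.  For \<open>i = 0\<close> and for \<open>i > n\<close> the exponent is \<open>d = 2n + 1\<close>, and the
  abelianizations are isomorphic because they have the same presentation.  For
  \<open>1 \<le> i \<le> n\<close> it is \<open>d = 2i\<close>.  The exponent is recovered from the ring as the largest \<open>k\<close> for
  which some nilpotent element has a non-zero \<open>k\<close>-th power, so different exponents give
  non-isomorphic algebras.

  To turn this into a proof, each abelianization is written as a quotient of the power series ring by
  a single ideal, generated by the relations together with all commutators
  (\<open>abelianization_of_quotient\<close>).  The main point is that this ideal depends on \<open>d\<close> only and is described by
  finitely many linear conditions on coefficients (\<open>genideal_relations_commutators\<close>).  The ideals in question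
  are purely algebraic, which raises the question whether infinitely many words can be removed by
  finite sums.  They can, because the relations kill finitely many words such that every other word,
  apart from \<open>1, a, a\<^sup>2, b, \<dots>, b\<^sup>d\<close>, has one of them as a prefix (\<open>gorenstein_ideal_subset\<close>).
  Given this description, the positive half of the theorem is \<open>alg_isomorphic_if_same_kernel\<close>, and the negative
  half compares the sets \<open>nilpotent_orders\<close> (\<open>nilpotent_orders_abelianization_A\<close>).
\<close>


section \<open>Algebras and their quotients\<close>

lemma (in abelian_group) minus_eq_zero_iff:
  assumes "x \<in> carrier G" "y \<in> carrier G"
  shows "x \<ominus> y = \<zero> \<longleftrightarrow> x = y"
  using assms by (metis a_inv_closed minus_eq minus_equality minus_minus r_neg)

text \<open>
  Scalars enter only through the elements \<open>c \<odot> \<one>\<close>.  This is enough for every ideal to be closed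
  under scalars, and it passes to quotients.
\<close>

locale unital_algebra = ring M for M :: "('k, 'a, 'm) module_scheme" (structure) +
  assumes smult_one_closed: "c \<odot> \<one> \<in> carrier M"
    and smult_eq_mult: "x \<in> carrier M \<Longrightarrow> c \<odot> x = (c \<odot> \<one>) \<otimes> x"
begin

lemma smult_closed: "x \<in> carrier M \<Longrightarrow> c \<odot> x \<in> carrier M"
  by (subst smult_eq_mult) (auto simp: smult_one_closed)

lemma smult_r_distr:
  "x \<in> carrier M \<Longrightarrow> y \<in> carrier M \<Longrightarrow> c \<odot> (x \<oplus> y) = c \<odot> x \<oplus> c \<odot> y"
  using smult_eq_mult[of "x \<oplus> y" c] smult_eq_mult[of x c] smult_eq_mult[of y c]
  by (simp add: r_distr smult_one_closed)

lemma smult_ideal: "ideal I M \<Longrightarrow> x \<in> I \<Longrightarrow> c \<odot> x \<in> I"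
  by (metis ideal.I_l_closed ideal.Icarr smult_eq_mult smult_one_closed)

lemma smult_coset:
  assumes "ideal I M" "x \<in> carrier M"
  shows "c \<odot>\<^bsub>alg_quot M I\<^esub> (I +> x) = I +> (c \<odot> x)"
  by (rule alg_quot_smult[OF assms]) (simp_all add: smult_closed smult_r_distr smult_ideal assms)

end

definition alg_hom ::
    "('k, 'a, 'm) module_scheme \<Rightarrow> ('k, 'b, 'n) module_scheme \<Rightarrow> ('a \<Rightarrow> 'b) set" where
  "alg_hom M N =
    {h \<in> ring_hom M N. \<forall>c. \<forall>x\<in>carrier M. h (c \<odot>\<^bsub>M\<^esub> x) = c \<odot>\<^bsub>N\<^esub> h x}"

locale alg_epimorphism = M: unital_algebra M + N: unital_algebra N
  for M :: "('k, 'a, 'm) module_scheme" and N :: "('k, 'b, 'n) module_scheme" +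
  fixes h
  assumes alg_hom: "h \<in> alg_hom M N"
    and surjective: "h ` carrier M = carrier N"

sublocale alg_epimorphism \<subseteq> ring_hom_ring M N h
  using alg_hom by (intro ring_hom_ringI2) (auto simp: alg_hom_def M.ring_axioms N.ring_axioms)

lemma alg_epimorphism_comp:
  assumes "alg_epimorphism M N g" "alg_epimorphism N P h"
  shows "alg_epimorphism M P (h \<circ> g)"
proof -
  interpret g: alg_epimorphism M N g by fact
  interpret h: alg_epimorphism N P h by fact
  show ?thesis
  proof unfold_locales
    show "h \<circ> g \<in> alg_hom M P"
      using g.alg_hom h.alg_hom ring_hom_trans[of g M N h P]
      by (auto simp: alg_hom_def)
    show "(h \<circ> g) ` carrier M = carrier P"
      by (metis g.surjective h.surjective image_comp)
  qed
qed

lemma (in unital_algebra) projection_epimorphism: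
  assumes "ideal I M"
  shows "alg_epimorphism M (alg_quot M I) ((+>) I)"
proof -
  interpret I: ideal I M by fact
  interpret Q: ring "alg_quot M I" by (rule alg_quot_ring) fact
  have carrier_quot: "carrier (alg_quot M I) = (+>) I ` carrier M"
    by (auto simp: alg_quot_def FactRing_def A_RCOSETS_def')
  have mult: "(I +> x) \<otimes>\<^bsub>alg_quot M I\<^esub> (I +> y) = I +> (x \<otimes> y)"
    if "x \<in> carrier M" "y \<in> carrier M" for x y
    using that by (simp add: alg_quot_def FactRing_def I.rcoset_mult_add)
  have add: "(I +> x) \<oplus>\<^bsub>alg_quot M I\<^esub> (I +> y) = I +> (x \<oplus> y)"
    if "x \<in> carrier M" "y \<in> carrier M" for x y
    using that by (simp add: alg_quot_def FactRing_def I.a_rcos_sum)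
  have one: "\<one>\<^bsub>alg_quot M I\<^esub> = I +> \<one>"
    by (simp add: alg_quot_def FactRing_def)
  show ?thesis
  proof unfold_locales
    fix c X
    show "c \<odot>\<^bsub>alg_quot M I\<^esub> \<one>\<^bsub>alg_quot M I\<^esub> \<in> carrier (alg_quot M I)"
      by (simp add: one smult_coset assms carrier_quot smult_closed)
    assume "X \<in> carrier (alg_quot M I)"
    then obtain x where "x \<in> carrier M" "X = I +> x" by (auto simp: carrier_quot)
    then show "c \<odot>\<^bsub>alg_quot M I\<^esub> X
        = (c \<odot>\<^bsub>alg_quot M I\<^esub> \<one>\<^bsub>alg_quot M I\<^esub>) \<otimes>\<^bsub>alg_quot M I\<^esub> X"
      by (simp add: one smult_coset assms smult_closed mult smult_eq_mult[symmetric])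
  next
    show "(+>) I \<in> alg_hom M (alg_quot M I)"
      unfolding alg_hom_def
      by (auto intro!: ring_hom_memI simp: smult_coset assms mult add one carrier_quot)
  qed (simp add: carrier_quot)
qed

lemma (in unital_algebra) kernel_projection:
  assumes "ideal I M"
  shows "a_kernel M (alg_quot M I) ((+>) I) = I"
proof -
  interpret I: ideal I M by fact
  have zero: "\<zero>\<^bsub>alg_quot M I\<^esub> = I" by (simp add: alg_quot_def FactRing_def)
  have "I +> x = I \<longleftrightarrow> x \<in> I" if "x \<in> carrier M" for x
    using that I.rcos_const_imp_mem a_rcos_zero[OF assms] by metis
  then show ?thesis
    unfolding a_kernel_def' zero using I.a_subset by blast
qed

lemma (in alg_epimorphism) image_ideal:
  assumes "ideal I M"
  shows "ideal (h ` I) N"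
proof (rule idealI)
  interpret I: ideal I M by fact
  show "ring N" by (rule N.ring_axioms)
  show "subgroup (h ` I) (add_monoid N)"
    by (rule img_is_add_subgroup) (rule I.a_subgroup)
  fix y z assume y: "y \<in> h ` I" and z: "z \<in> carrier N"
  obtain x where x: "x \<in> I" "y = h x" using y by blast
  obtain w where w: "w \<in> carrier M" "z = h w" using z surjective by blast
  have eq: "z \<otimes>\<^bsub>N\<^esub> y = h (w \<otimes>\<^bsub>M\<^esub> x)" "y \<otimes>\<^bsub>N\<^esub> z = h (x \<otimes>\<^bsub>M\<^esub> w)"
    using x w by (simp_all add: I.Icarr)
  show "z \<otimes>\<^bsub>N\<^esub> y \<in> h ` I" "y \<otimes>\<^bsub>N\<^esub> z \<in> h ` I"
    unfolding eq by (rule imageI, rule I.I_l_closed I.I_r_closed, fact x, fact w)+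
qed

lemma (in alg_epimorphism) hom_minus:
  assumes "x \<in> carrier M" "y \<in> carrier M"
  shows "h (x \<ominus>\<^bsub>M\<^esub> y) = h x \<ominus>\<^bsub>N\<^esub> h y"
  using assms by (simp only: M.minus_eq N.minus_eq hom_add M.a_inv_closed hom_a_inv)

lemma (in alg_epimorphism) minus_in_kernel_iff:
  assumes "x \<in> carrier M" "y \<in> carrier M"
  shows "x \<ominus>\<^bsub>M\<^esub> y \<in> a_kernel M N h \<longleftrightarrow> h x = h y"
proof -
  have "x \<ominus>\<^bsub>M\<^esub> y \<in> a_kernel M N h \<longleftrightarrow> h x \<ominus>\<^bsub>N\<^esub> h y = \<zero>\<^bsub>N\<^esub>"
    unfolding a_kernel_def' mem_Collect_eq hom_minus[OF assms]
    using M.minus_closed[OF assms] by blast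
  also have "\<dots> \<longleftrightarrow> h x = h y"
    by (rule N.minus_eq_zero_iff) (intro hom_closed assms)+
  finally show ?thesis .
qed

text \<open>
  The ideal that \<open>S \<union> T\<close> generates in \<open>M\<close> contains the kernel, and its image is an ideal of \<open>N\<close>
  that contains \<open>h ` T\<close>; so anything mapped into the ideal generated by \<open>h ` T\<close> differs from an
  element of it by an element of the kernel.
\<close>

lemma (in alg_epimorphism) vimage_genideal:
  assumes S: "S \<subseteq> carrier M" and T: "T \<subseteq> carrier M"
    and kernel: "a_kernel M N h = genideal M S"
  shows "{x \<in> carrier M. h x \<in> genideal N (h ` T)} = genideal M (S \<union> T)"
proof
  let ?I = "genideal M (S \<union> T)"
  interpret I: ideal ?I M using S T by (intro M.genideal_ideal) simp
  have hT: "h ` T \<subseteq> carrier N" using T by auto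
  have gen: "S \<union> T \<subseteq> ?I" using S T by (intro M.genideal_self) simp
  have "genideal M S \<subseteq> ?I"
    using gen by (intro M.genideal_minimal I.is_ideal) simp
  then have ker: "a_kernel M N h \<subseteq> ?I" by (simp add: kernel)
  have gen_img: "genideal N (h ` T) \<subseteq> h ` ?I"
    using gen by (intro N.genideal_minimal image_ideal I.is_ideal) auto
  show "{x \<in> carrier M. h x \<in> genideal N (h ` T)} \<subseteq> ?I"
  proof clarify
    fix x assume x: "x \<in> carrier M" "h x \<in> genideal N (h ` T)"
    then have "h x \<in> h ` ?I" by (intro rev_subsetD[OF x(2) gen_img])
    then obtain y where y: "y \<in> ?I" "h x = h y" by (elim imageE)
    then have yc: "y \<in> carrier M" by (simp add: I.Icarr)
    have "x \<ominus>\<^bsub>M\<^esub> y \<in> a_kernel M N h"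
      using minus_in_kernel_iff[OF x(1) yc] y(2) by blast
    then have "(x \<ominus>\<^bsub>M\<^esub> y) \<oplus>\<^bsub>M\<^esub> y \<in> ?I" using ker y by (intro I.a_closed) auto
    moreover have "(x \<ominus>\<^bsub>M\<^esub> y) \<oplus>\<^bsub>M\<^esub> y = x"
      using x yc by (simp add: M.minus_eq M.a_assoc M.l_neg)
    ultimately show "x \<in> ?I" by simp
  qed
  interpret J: ideal "genideal N (h ` T)" N by (rule N.genideal_ideal[OF hT])
  have S_ker: "S \<subseteq> a_kernel M N h" unfolding kernel by (rule M.genideal_self[OF S])
  have "h x = \<zero>\<^bsub>N\<^esub>" if "x \<in> S" for x
    using subsetD[OF S_ker that] unfolding a_kernel_def' mem_Collect_eq by (rule conjunct2)
  then have "h x \<in> genideal N (h ` T)" if "x \<in> S" for x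
    using that J.zero_closed by metis
  then have "S \<subseteq> {x \<in> carrier M. h x \<in> genideal N (h ` T)}" using S by blast
  moreover have "T \<subseteq> {x \<in> carrier M. h x \<in> genideal N (h ` T)}"
    using T N.genideal_self[OF hT] by blast
  ultimately have "S \<union> T \<subseteq> {x \<in> carrier M. h x \<in> genideal N (h ` T)}"
    by (rule Un_least)
  then show "?I \<subseteq> {x \<in> carrier M. h x \<in> genideal N (h ` T)}"
    by (intro M.genideal_minimal ideal_vimage J.is_ideal)
qed


section \<open>Abelianization of a quotient\<close>

definition commutators :: "('a, 'm) ring_scheme \<Rightarrow> 'a set" where
  "commutators M =
    {(x \<otimes>\<^bsub>M\<^esub> y) \<ominus>\<^bsub>M\<^esub> (y \<otimes>\<^bsub>M\<^esub> x) | x y. x \<in> carrier M \<and> y \<in> carrier M}"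

lemma (in ring) commutators_closed: "commutators R \<subseteq> carrier R"
  by (auto simp: commutators_def)

lemma (in alg_epimorphism) image_commutators: "h ` commutators M = commutators N"
proof -
  have hom: "h ((x \<otimes>\<^bsub>M\<^esub> y) \<ominus>\<^bsub>M\<^esub> (y \<otimes>\<^bsub>M\<^esub> x)) = (h x \<otimes>\<^bsub>N\<^esub> h y) \<ominus>\<^bsub>N\<^esub> (h y \<otimes>\<^bsub>N\<^esub> h x)"
    if "x \<in> carrier M" "y \<in> carrier M" for x y
    using that by (simp only: hom_minus M.m_closed hom_mult)
  show ?thesis
  proof
    show "h ` commutators M \<subseteq> commutators N"
    proof
      fix z assume "z \<in> h ` commutators M"
      then obtain x y where xy: "x \<in> carrier M" "y \<in> carrier M"
        and z: "z = h ((x \<otimes>\<^bsub>M\<^esub> y) \<ominus>\<^bsub>M\<^esub> (y \<otimes>\<^bsub>M\<^esub> x))"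
        unfolding commutators_def by (elim imageE CollectE exE conjE) simp
      show "z \<in> commutators N"
        unfolding z hom[OF xy] commutators_def using xy hom_closed by blast
    qed
    show "commutators N \<subseteq> h ` commutators M"
    proof
      fix z assume "z \<in> commutators N"
      then obtain u v where uv: "u \<in> carrier N" "v \<in> carrier N"
        and z: "z = (u \<otimes>\<^bsub>N\<^esub> v) \<ominus>\<^bsub>N\<^esub> (v \<otimes>\<^bsub>N\<^esub> u)"
        unfolding commutators_def by (elim CollectE exE conjE)
      obtain x where x: "x \<in> carrier M" "u = h x" using uv(1) surjective by (metis imageE)
      obtain y where y: "y \<in> carrier M" "v = h y" using uv(2) surjective by (metis imageE)
      have "z = h ((x \<otimes>\<^bsub>M\<^esub> y) \<ominus>\<^bsub>M\<^esub> (y \<otimes>\<^bsub>M\<^esub> x))"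
        unfolding z x(2) y(2) by (rule hom[OF x(1) y(1), symmetric])
      moreover have "(x \<otimes>\<^bsub>M\<^esub> y) \<ominus>\<^bsub>M\<^esub> (y \<otimes>\<^bsub>M\<^esub> x) \<in> commutators M"
        unfolding commutators_def using x(1) y(1) by blast
      ultimately show "z \<in> h ` commutators M" by (rule image_eqI)
    qed
  qed
qed

text \<open>
  The commutators of the quotient are the images of those of \<open>M\<close>, so the preimage of the ideal they
  generate, which is the kernel of the composite projection, is given by \<open>vimage_genideal\<close>.
\<close>

lemma (in unital_algebra) abelianization_of_quotient:
  assumes S: "S \<subseteq> carrier M"
  obtains h where "alg_epimorphism M (abelianization (alg_quot M (genideal M S))) h"
    and "a_kernel M (abelianization (alg_quot M (genideal M S))) h
      = genideal M (S \<union> commutators M)"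
proof -
  let ?I = "genideal M S" and ?Q = "alg_quot M (genideal M S)"
  have I: "ideal ?I M" using S by (rule genideal_ideal)
  interpret p: alg_epimorphism M ?Q "(+>) ?I" by (rule projection_epimorphism[OF I])
  let ?C = "genideal ?Q (commutators ?Q)"
  have C: "ideal ?C ?Q" by (intro p.N.genideal_ideal p.N.commutators_closed)
  have ab: "abelianization ?Q = alg_quot ?Q ?C"
    by (simp add: abelianization_def commutators_def)
  have q: "alg_epimorphism ?Q (abelianization ?Q) ((+>\<^bsub>?Q\<^esub>) ?C)"
    unfolding ab by (rule p.N.projection_epimorphism[OF C])
  let ?h = "(+>\<^bsub>?Q\<^esub>) ?C \<circ> (+>) ?I"
  have "a_kernel M (abelianization ?Q) ?h
      = {x \<in> carrier M. ?I +> x \<in> a_kernel ?Q (alg_quot ?Q ?C) ((+>\<^bsub>?Q\<^esub>) ?C)}"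
    unfolding a_kernel_def' ab o_def mem_Collect_eq
    by (intro Collect_cong conj_cong refl) (simp only: p.hom_closed simp_thms)
  also have "\<dots> = {x \<in> carrier M. ?I +> x \<in> genideal ?Q ((+>) ?I ` commutators M)}"
    unfolding p.N.kernel_projection[OF C] p.image_commutators ..
  also have "\<dots> = genideal M (S \<union> commutators M)"
    by (rule p.vimage_genideal[OF S commutators_closed kernel_projection[OF I]])
  finally show thesis
    by (rule that[OF alg_epimorphism_comp[OF p.alg_epimorphism_axioms q]])
qed


section \<open>Criteria for isomorphism and non-isomorphism\<close>

lemma alg_isomorphic_if_same_kernel:
  assumes "alg_epimorphism M N g" "alg_epimorphism M P h"
    and same: "a_kernel M N g = a_kernel M P h"
  shows "alg_isomorphic N P"
proof -
  interpret g: alg_epimorphism M N g by fact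
  interpret h: alg_epimorphism M P h by fact
  have eq_iff: "g x = g y \<longleftrightarrow> h x = h y" if "x \<in> carrier M" "y \<in> carrier M" for x y
    using g.minus_in_kernel_iff[OF that] h.minus_in_kernel_iff[OF that] same by metis
  define \<phi> where "\<phi> = (\<lambda>y. h (inv_into (carrier M) g y))"
  have \<phi>: "\<phi> (g x) = h x" if "x \<in> carrier M" for x
  proof -
    have "g x \<in> g ` carrier M" using that by (rule imageI)
    then show ?thesis
      unfolding \<phi>_def using eq_iff[OF inv_into_into that] f_inv_into_f by metis
  qed
  have "\<phi> \<in> alg_iso N P"
    unfolding alg_iso_def
  proof (intro CollectI conjI ballI allI ring_iso_memI)
    fix c u assume "u \<in> carrier N"
    then obtain x where x: "x \<in> carrier M" "u = g x" using g.surjective by blast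
    then have "c \<odot>\<^bsub>N\<^esub> u = g (c \<odot>\<^bsub>M\<^esub> x)" "c \<odot>\<^bsub>P\<^esub> h x = h (c \<odot>\<^bsub>M\<^esub> x)"
      using g.alg_hom h.alg_hom by (simp_all add: alg_hom_def)
    then show "\<phi> (c \<odot>\<^bsub>N\<^esub> u) = c \<odot>\<^bsub>P\<^esub> \<phi> u"
      by (simp only: x \<phi> g.M.smult_closed)
    show "\<phi> u \<in> carrier P" by (simp only: x \<phi> h.hom_closed)
    fix v assume "v \<in> carrier N"
    then obtain y where y: "y \<in> carrier M" "v = g y" using g.surjective by blast
    show "\<phi> (u \<otimes>\<^bsub>N\<^esub> v) = \<phi> u \<otimes>\<^bsub>P\<^esub> \<phi> v"
      by (simp only: x y \<phi> g.hom_mult[symmetric] h.hom_mult[symmetric] g.M.m_closed)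
    show "\<phi> (u \<oplus>\<^bsub>N\<^esub> v) = \<phi> u \<oplus>\<^bsub>P\<^esub> \<phi> v"
      by (simp only: x y \<phi> g.hom_add[symmetric] h.hom_add[symmetric] g.M.a_closed)
  next
    show "\<phi> \<one>\<^bsub>N\<^esub> = \<one>\<^bsub>P\<^esub>" using \<phi>[of "\<one>\<^bsub>M\<^esub>"] by simp
  next
    have "inj_on \<phi> (carrier N)"
      unfolding inj_on_def g.surjective[symmetric] ball_simps using eq_iff \<phi> by simp
    moreover have "\<phi> ` carrier N = carrier P"
      unfolding g.surjective[symmetric] h.surjective[symmetric] image_image
      by (intro image_cong refl \<phi>)
    ultimately show "bij_betw \<phi> (carrier N) (carrier P)" unfolding bij_betw_def by (rule conjI)
  qed
  then show ?thesis by (auto simp: alg_isomorphic_def)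
qed

text \<open>
  An isomorphism invariant that replaces the dimension: in a local algebra with nilpotent maximal ideal
  \<open>m\<close>, the nilpotent elements are those of \<open>m\<close>, and the exponents collected here record how far their
  powers reach before they all vanish.
\<close>

definition nilpotent_orders :: "('a, 'm) ring_scheme \<Rightarrow> nat set" where
  "nilpotent_orders M = {k. \<exists>x\<in>carrier M. x [^]\<^bsub>M\<^esub> k \<noteq> \<zero>\<^bsub>M\<^esub> \<and>
      (\<exists>N::nat. x [^]\<^bsub>M\<^esub> N = \<zero>\<^bsub>M\<^esub>)}"

lemma nilpotent_orders_subset:
  assumes "ring M" "ring N" and "\<phi> \<in> ring_iso M N"
  shows "nilpotent_orders M \<subseteq> nilpotent_orders N"
proof -
  interpret ring_hom_ring M N \<phi>
    using assms by (intro ring_hom_ringI2) (auto simp: ring_iso_def)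
  have inj: "inj_on \<phi> (carrier M)" using assms(3) by (auto simp: ring_iso_def bij_betw_def)
  have "\<phi> x = \<zero>\<^bsub>N\<^esub> \<longleftrightarrow> x = \<zero>\<^bsub>M\<^esub>" if "x \<in> carrier M" for x
    using inj_onD[OF inj _ that, of "\<zero>\<^bsub>M\<^esub>"] by auto
  then have "\<phi> x [^]\<^bsub>N\<^esub> (k::nat) = \<zero>\<^bsub>N\<^esub> \<longleftrightarrow> x [^]\<^bsub>M\<^esub> k = \<zero>\<^bsub>M\<^esub>"
    if "x \<in> carrier M" for x k
    using that by (simp flip: hom_nat_pow)
  then show ?thesis
    unfolding nilpotent_orders_def using hom_closed by blast
qed

lemma nilpotent_orders_eq:
  assumes "ring M" "ring N" and "alg_isomorphic M N"
  shows "nilpotent_orders M = nilpotent_orders N"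
proof -
  obtain \<phi> where "\<phi> \<in> ring_iso M N" using assms by (auto simp: alg_isomorphic_def alg_iso_def)
  moreover from this have "inv_into (carrier M) \<phi> \<in> ring_iso N M"
    using assms(1) by (simp add: ring_iso_set_sym)
  ultimately show ?thesis using assms(1,2) by (meson nilpotent_orders_subset subset_antisym)
qed

lemma (in alg_epimorphism) nilpotent_orders_image:
  "nilpotent_orders N = {k. \<exists>x\<in>carrier M. x [^]\<^bsub>M\<^esub> k \<notin> a_kernel M N h \<and>
      (\<exists>m::nat. x [^]\<^bsub>M\<^esub> m \<in> a_kernel M N h)}"
  unfolding nilpotent_orders_def a_kernel_def' surjective[symmetric]
  by (auto simp: hom_nat_pow[symmetric])


section \<open>Words in the power series ring\<close>

definition word :: "'x list \<Rightarrow> 'x list \<Rightarrow> 'k::field" where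
  "word u = (\<lambda>w. if w = u then 1 else 0)"

definition left_quotient :: "'x list \<Rightarrow> ('x list \<Rightarrow> 'k) \<Rightarrow> 'x list \<Rightarrow> 'k" where
  "left_quotient u f = (\<lambda>w. f (u @ w))"

lemma unital_algebra_NCPS: "unital_algebra (NCPS :: ('k::field, 'x list \<Rightarrow> 'k) module)"
proof -
  interpret ring "NCPS :: ('k::field, 'x list \<Rightarrow> 'k) module" by (rule ring_NCPS)
  show ?thesis
    by unfold_locales (auto simp: NCPS_def nc_mult_scale_left nc_mult_one_left)
qed

interpretation NCPS: unital_algebra "NCPS :: ('k::field, 'x list \<Rightarrow> 'k) module"
  by (rule unital_algebra_NCPS)

lemma NCPS_simps:
  "carrier NCPS = UNIV" "f \<otimes>\<^bsub>NCPS\<^esub> g = nc_mult f g" "f \<oplus>\<^bsub>NCPS\<^esub> g = (\<lambda>w. f w + g w)"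
  "c \<odot>\<^bsub>NCPS\<^esub> f = (\<lambda>w. c * f w)" "\<zero>\<^bsub>NCPS\<^esub> = (\<lambda>w. 0)" "\<one>\<^bsub>NCPS\<^esub> = word []"
  by (simp_all add: NCPS_def word_def)

lemma NCPS_uminus: "\<ominus>\<^bsub>NCPS\<^esub> f = (\<lambda>w. - f w)"
  by (rule NCPS.minus_equality) (simp_all add: NCPS_simps)

lemma NCPS_minus: "f \<ominus>\<^bsub>NCPS\<^esub> g = (\<lambda>w. f w - g w)"
  by (simp add: NCPS.minus_eq NCPS_uminus NCPS_simps)

lemma word_mult:
  fixes f :: "'x list \<Rightarrow> 'k::field"
  shows "nc_mult (word u) f w = (if take (length u) w = u then f (drop (length u) w) else 0)"
proof (induction u arbitrary: w)
  case Nil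
  show ?case by (simp add: word_def nc_mult_one_left)
next
  case (Cons x u)
  have "word (x # u) [] = (0::'k)"
    and "(\<lambda>v. word (x # u) (y # v)) = (if x = y then word u else (\<lambda>v. 0::'k))" for y
    by (auto simp: word_def)
  then show ?case
    using Cons.IH
    by (cases w) (auto simp: nc_mult_Nil nc_mult_Cons nc_mult_zero_left)
qed

lemma word_mult_word: "nc_mult (word u) (word v) = word (u @ v)"
proof
  fix w
  have "w = u @ v \<longleftrightarrow> take (length u) w = u \<and> drop (length u) w = v"
    by (metis append_eq_conv_conj)
  then show "nc_mult (word u) (word v) w = word (u @ v) w"
    unfolding word_mult by (simp add: word_def)
qed

lemma nc_var_eq_word: "nc_var x = word [x]"
  by (simp add: nc_var_def word_def)

lemma word_power: "word [x] [^]\<^bsub>NCPS\<^esub> (k::nat) = word (replicate k x)"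
proof (induction k)
  case (Suc k)
  then show ?case by (simp add: NCPS_simps word_mult_word replicate_append_same)
qed (simp add: NCPS_simps)

lemma power_Nil: "(f [^]\<^bsub>NCPS\<^esub> (k::nat)) [] = f [] ^ k"
  by (induction k) (simp_all add: NCPS_simps word_def nc_mult_Nil)

lemma power_eq_0_if_short:
  assumes "f [] = 0" "length w < k"
  shows "(f [^]\<^bsub>NCPS\<^esub> (k::nat)) w = 0"
  using assms(2)
proof (induction k arbitrary: w)
  case (Suc k)
  have "(f [^]\<^bsub>NCPS\<^esub> k) (take i w) * f (drop i w) = 0" if "i \<le> length w" for i
    using Suc that assms(1) by (cases "i = length w") auto
  then have "(\<Sum>i\<le>length w. (f [^]\<^bsub>NCPS\<^esub> k) (take i w) * f (drop i w)) = 0"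
    by (intro sum.neutral) simp
  then show ?case by (simp add: NCPS_simps nc_mult_def)
qed simp

text \<open>
  The equation \<open>f * g = 1\<close>, solved for the coefficient of \<open>g\<close> at \<open>w\<close>; the remaining terms involve
  \<open>g\<close> only at proper suffixes of \<open>w\<close>.
\<close>

function right_inverse :: "('x list \<Rightarrow> 'k::field) \<Rightarrow> 'x list \<Rightarrow> 'k" where
  "right_inverse f w = (word [] w
      - (\<Sum>i<length w. f (take (Suc i) w) * right_inverse f (drop (Suc i) w))) / f []"
  by auto
termination by (relation "measure (\<lambda>(f, w). length w)") auto

declare right_inverse.simps [simp del]

lemma mult_right_inverse:
  assumes "f [] \<noteq> 0"
  shows "nc_mult f (right_inverse f) = word []"
proof
  fix w
  have "nc_mult f (right_inverse f) w = f [] * right_inverse f w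
      + (\<Sum>i<length w. f (take (Suc i) w) * right_inverse f (drop (Suc i) w))"
    unfolding nc_mult_def
    by (cases w) (simp_all add: lessThan_Suc_atMost[symmetric] sum.lessThan_Suc_shift
        del: sum.lessThan_Suc)
  then show "nc_mult f (right_inverse f) w = word [] w"
    using assms by (simp add: right_inverse.simps[of f w])
qed

context
  fixes I :: "('x list \<Rightarrow> 'k::field) set"
  assumes I: "ideal I NCPS"
begin

interpretation ideal I NCPS by (rule I)

lemma ideal_add: "f \<in> I \<Longrightarrow> g \<in> I \<Longrightarrow> (\<lambda>w. f w + g w) \<in> I"
  using a_closed by (simp add: NCPS_simps)

lemma ideal_scale: "f \<in> I \<Longrightarrow> (\<lambda>w. c * f w) \<in> I"
  using NCPS.smult_ideal[OF I] by (simp add: NCPS_simps)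

lemma ideal_diff: "f \<in> I \<Longrightarrow> g \<in> I \<Longrightarrow> (\<lambda>w. f w - g w) \<in> I"
  using ideal_add[of f "\<lambda>w. - 1 * g w"] ideal_scale[of g "- 1"] by simp

lemma ideal_mult: "f \<in> I \<Longrightarrow> nc_mult g f \<in> I" "f \<in> I \<Longrightarrow> nc_mult f g \<in> I"
  using I_l_closed I_r_closed by (simp_all add: NCPS_simps)

lemma ideal_word: "word u \<in> I \<Longrightarrow> word (v @ u @ v') \<in> I"
  by (simp add: word_mult_word[symmetric] ideal_mult)

end


section \<open>The ideal of the abelianized relations\<close>

abbreviation b_power :: "nat \<Rightarrow> letter list" where
  "b_power j \<equiv> replicate j Letter_b"

text \<open>
  The kernel of the map from the power series ring onto the local algebra
  \<open>k[[a,b]]/(ab, a\<^sup>2 + b\<^sup>d)\<close>, read off in the basis \<open>1, a, b, \<dots>, b\<^sup>d\<close> of the latter: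
  since \<open>a\<^sup>2 = - b\<^sup>d\<close> there, the coordinate at \<open>b\<^sup>d\<close> is the coefficient of \<open>b\<^sup>d\<close> minus that
  of \<open>a\<^sup>2\<close>, while the words outside \<open>1, a, a\<^sup>2, b, \<dots>, b\<^sup>d\<close> become zero.  The algebra is a complete
  intersection, hence Gorenstein, and \<open>b\<^sup>d\<close> spans its socle when \<open>d \<ge> 2\<close>.
\<close>

definition gorenstein_ideal :: "nat \<Rightarrow> (letter list \<Rightarrow> complex) set" where
  "gorenstein_ideal d = {f. f [Letter_a] = 0 \<and> (\<forall>j<d. f (b_power j) = 0)
     \<and> f (b_power d) = f [Letter_a, Letter_a]}"

lemma mult_b_power_left:
  assumes "\<And>i. i < j \<Longrightarrow> f (b_power i) = 0"
  shows "nc_mult f g (b_power j) = f (b_power j) * g []"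
  using assms by (simp add: nc_mult_def lessThan_Suc_atMost[symmetric])

lemma mult_b_power_right:
  assumes "\<And>i. i < j \<Longrightarrow> f (b_power i) = 0"
  shows "nc_mult g f (b_power j) = g [] * f (b_power j)"
  using assms by (simp add: nc_mult_def sum.atMost_shift del: sum.atMost_Suc)

text \<open>
  For \<open>f\<close> in the ideal, multiplication by \<open>g\<close> on either side scales each of the coefficients in
  question by the constant term of \<open>g\<close>, because those at proper prefixes and suffixes vanish.
\<close>

lemma ideal_gorenstein_ideal:
  assumes d: "d > 0"
  shows "ideal (gorenstein_ideal d) Cab"
proof (rule idealI)
  show "ring Cab" by (rule NCPS.ring_axioms)
  show "subgroup (gorenstein_ideal d) (add_monoid Cab)"
  proof (rule NCPS.add.subgroupI)
    show "gorenstein_ideal d \<noteq> {}" by (auto simp: gorenstein_ideal_def intro!: exI[of _ "\<lambda>w. 0"])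
    fix f g assume "f \<in> gorenstein_ideal d" "g \<in> gorenstein_ideal d"
    then show "f \<oplus>\<^bsub>Cab\<^esub> g \<in> gorenstein_ideal d" by (simp add: NCPS_simps gorenstein_ideal_def)
    from \<open>f \<in> _\<close> show "\<ominus>\<^bsub>Cab\<^esub> f \<in> gorenstein_ideal d" by (simp add: NCPS_uminus gorenstein_ideal_def)
  qed (simp add: NCPS_simps)
  fix f g assume f: "f \<in> gorenstein_ideal d"
  have f0: "f [] = 0" using f d by (force simp: gorenstein_ideal_def)
  show "g \<otimes>\<^bsub>Cab\<^esub> f \<in> gorenstein_ideal d"
    using f f0 by (simp add: NCPS_simps gorenstein_ideal_def mult_b_power_right nc_mult_Nil nc_mult_Cons)
  show "f \<otimes>\<^bsub>Cab\<^esub> g \<in> gorenstein_ideal d"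
    using f f0 by (simp add: NCPS_simps gorenstein_ideal_def mult_b_power_left nc_mult_Nil nc_mult_Cons)
qed

text \<open>
  The words \<open>a\<close>, \<open>a\<^sup>2\<close> and \<open>b\<^sup>j\<close> are powers of a single letter, and splitting such a word is
  symmetric, so on them \<open>f * g\<close> and \<open>g * f\<close> have the same coefficients.
\<close>

lemma commutators_subset_gorenstein_ideal: "commutators Cab \<subseteq> gorenstein_ideal d"
proof -
  have "nc_mult f g (b_power j) = nc_mult g f (b_power j)" for f g :: "letter list \<Rightarrow> complex" and j
    unfolding nc_mult_def
    by (rule sum.reindex_bij_witness[of _ "\<lambda>i. j - i" "\<lambda>i. j - i"]) (auto simp: min_def)
  then show ?thesis
    by (auto simp: commutators_def NCPS_simps NCPS_minus gorenstein_ideal_def nc_mult_Nil nc_mult_Cons)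
qed

text \<open>
  The lowest power of \<open>b\<close> in the second relation of \<open>A n i\<close>: the term \<open>b\<^sup>2\<^sup>i\<close> is absent for
  \<open>i = 0\<close> and lies above \<open>b\<^sup>2\<^sup>n\<^sup>+\<^sup>1\<close> for \<open>i > n\<close>.
\<close>

definition socle_degree :: "nat \<Rightarrow> nat \<Rightarrow> nat" where
  "socle_degree n i = (if i = 0 \<or> n < i then 2 * n + 1 else 2 * i)"

lemma relations_eq_words:
  "relations n i = {\<lambda>w. word [Letter_a, Letter_b] w + word [Letter_b, Letter_a] w,
     \<lambda>w. word [Letter_a, Letter_a] w + word (b_power (2 * n + 1)) w
       + (if i = 0 then 0 else word (b_power (2 * i)) w)}"
  unfolding relations_def nc_var_eq_word word_power
  by (simp add: NCPS_simps word_mult_word numeral_2_eq_2)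

lemma relations_subset_gorenstein_ideal:
  assumes "n > 0"
  shows "relations n i \<subseteq> gorenstein_ideal (socle_degree n i)"
proof -
  have [simp]: "(b_power j = b_power k) = (j = k)" for j k by (metis length_replicate)
  have [simp]: "b_power j \<noteq> x # Letter_a # w" "b_power j \<noteq> Letter_a # w"
    "x # Letter_a # w \<noteq> b_power j" "Letter_a # w \<noteq> b_power j" for j x w
    by (cases j; cases "j - 1"; auto)+
  have "2 * i \<noteq> 2 * n + 1" by presburger
  then show ?thesis using assms
    by (auto simp: relations_eq_words gorenstein_ideal_def word_def socle_degree_def
        simp del: replicate_Suc)
qed


section \<open>Every ideal with these relations contains the Gorenstein ideal\<close>

text \<open>
  One step of expanding \<open>f\<close>: among the words that begin with \<open>u\<close>, either the word is \<open>u\<close> itself or it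
  goes on with \<open>a\<close> or with \<open>b\<close>.
\<close>

lemma word_mult_left_quotient:
  fixes f :: "letter list \<Rightarrow> 'k::field"
  shows "nc_mult (word u) (left_quotient u f) w = f u * word u w
    + nc_mult (word (u @ [Letter_a])) (left_quotient (u @ [Letter_a]) f) w
    + nc_mult (word (u @ [Letter_b])) (left_quotient (u @ [Letter_b]) f) w"
proof (cases "take (length u) w = u")
  case True
  then obtain v where v: "w = u @ v" by (metis append_take_drop_id)
  show ?thesis
  proof (cases v)
    case Nil
    then show ?thesis unfolding word_mult by (simp add: word_def left_quotient_def v)
  next
    case (Cons x v')
    then show ?thesis
      unfolding word_mult by (cases x) (simp_all add: word_def left_quotient_def v)
  qed
next
  case False
  moreover have "take (length u) (take (Suc (length u)) w) = take (length u) w" by simp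
  ultimately have "take (Suc (length u)) w \<noteq> u @ [x]" for x by force
  with False show ?thesis unfolding word_mult by (auto simp: word_def)
qed

text \<open>
  In the presence of commutators, \<open>2ab\<close> and \<open>2ba\<close> are combinations of \<open>ab + ba\<close> and \<open>ab - ba\<close>.
  Multiplying the second relation by \<open>b\<close> then kills \<open>ba\<^sup>2\<close> and leaves \<open>b\<^sup>d\<^sup>+\<^sup>1\<close>, for
  \<open>i > 0\<close> times the unit \<open>1 + b\<^sup>e\<close>, where \<open>d + e\<close> is the higher of the two exponents of \<open>b\<close>.  Once \<open>b\<^sup>d\<^sup>+\<^sup>1\<close> is known to lie
  in the ideal, the higher power of \<open>b\<close> can be dropped from the second relation.
\<close>

lemma relations_in_standard_form:
  assumes I: "ideal I Cab" and rel: "relations n i \<subseteq> I" and comm: "commutators Cab \<subseteq> I"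
    and n: "n > 0"
  defines "d \<equiv> socle_degree n i"
  shows "word [Letter_a, Letter_b] \<in> I" "word [Letter_b, Letter_a] \<in> I"
    "word (b_power (Suc d)) \<in> I"
    "(\<lambda>w. word [Letter_a, Letter_a] w + word (b_power d) w) \<in> I"
proof -
  let ?ab = "word [Letter_a, Letter_b] :: letter list \<Rightarrow> complex"
  let ?ba = "word [Letter_b, Letter_a] :: letter list \<Rightarrow> complex"
  have sum: "(\<lambda>w. ?ab w + ?ba w) \<in> I" using rel by (simp add: relations_eq_words)
  have "word [Letter_a] \<otimes>\<^bsub>Cab\<^esub> word [Letter_b] \<ominus>\<^bsub>Cab\<^esub> word [Letter_b] \<otimes>\<^bsub>Cab\<^esub> word [Letter_a]
      \<in> commutators Cab"
    by (force simp: commutators_def NCPS_simps)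
  then have diff: "(\<lambda>w. ?ab w - ?ba w) \<in> I"
    using comm by (auto simp: NCPS_simps NCPS_minus word_mult_word)
  show ab: "?ab \<in> I"
    using ideal_scale[OF I ideal_add[OF I sum diff], of "1/2"] by simp
  show ba: "?ba \<in> I"
    using ideal_diff[OF I sum ab] by simp
  define r where "r = (\<lambda>w. word [Letter_a, Letter_a] w + word (b_power (2 * n + 1)) w
       + (if i = 0 then 0 else word (b_power (2 * i)) w) :: complex)"
  have r: "r \<in> I" using rel by (simp add: relations_eq_words r_def)
  \<comment> \<open>The higher of the two exponents of \<open>b\<close>; for \<open>i = 0\<close> there is only one, and \<open>m\<close> takes its value.\<close>
  define m where "m = (if i = 0 then d else max (2 * n + 1) (2 * i))"
  have r_eq: "r = (\<lambda>w. word [Letter_a, Letter_a] w + word (b_power d) w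
      + (if i = 0 then 0 else word (b_power m) w))"
    by (auto simp: r_def d_def socle_degree_def m_def max_def fun_eq_iff)
  have "(\<lambda>w. nc_mult (word [Letter_b]) r w - nc_mult ?ba (word [Letter_a]) w) \<in> I"
    by (intro ideal_diff[OF I] ideal_mult[OF I] r ba)
  moreover have "(\<lambda>w. nc_mult (word [Letter_b]) r w - nc_mult ?ba (word [Letter_a]) w)
      = (\<lambda>w. word (b_power (Suc d)) w + (if i = 0 then 0 else word (b_power (Suc m)) w))"
    unfolding r_eq
    by (auto simp: nc_mult_add_right word_mult_word fun_eq_iff nc_mult_def[of _ "\<lambda>w. 0"])
  ultimately have br: "(\<lambda>w. word (b_power (Suc d)) w
      + (if i = 0 then 0 else word (b_power (Suc m)) w)) \<in> I"
    by simp
  show bd: "word (b_power (Suc d)) \<in> I"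
  proof (cases "i = 0")
    case True
    then show ?thesis using br by simp
  next
    case False
    then have "d < m" using n by (auto simp: d_def m_def socle_degree_def max_def) presburger+
    then obtain e where e: "m = d + e" "e > 0" using less_imp_add_positive by blast
    define u where "u = (\<lambda>w. word [] w + word (b_power e) w :: complex)"
    have "u [] \<noteq> 0" using e by (simp add: u_def word_def)
    then have "word (b_power (Suc d))
        = nc_mult (word (b_power (Suc d))) (nc_mult u (right_inverse u))"
      by (simp add: mult_right_inverse word_mult_word)
    also have "\<dots> = nc_mult (nc_mult (word (b_power (Suc d))) u) (right_inverse u)"
      by (simp add: fun_eq_iff nc_mult_assoc)
    also have "nc_mult (word (b_power (Suc d))) u
        = (\<lambda>w. word (b_power (Suc d)) w + word (b_power (Suc m)) w)"
      unfolding u_def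
      by (simp add: nc_mult_add_right word_mult_word fun_eq_iff e replicate_add)
    also have "nc_mult \<dots> (right_inverse u) \<in> I"
      using ideal_mult(2)[OF I br, of "right_inverse u"] False by simp
    finally show ?thesis .
  qed
  show "(\<lambda>w. word [Letter_a, Letter_a] w + word (b_power d) w) \<in> I"
  proof (cases "i = 0")
    case True
    then show ?thesis using r by (simp add: r_eq)
  next
    case False
    then have "m > d" using n by (auto simp: d_def m_def socle_degree_def max_def) presburger+
    then have "b_power m = [] @ b_power (Suc d) @ b_power (m - Suc d)"
      by (simp add: replicate_add[symmetric] del: replicate_Suc)
    then have "word (b_power m) \<in> I" using ideal_word[OF I bd] by metis
    then show ?thesis using ideal_diff[OF I r, of "word (b_power m)"] False by (simp add: r_eq)
  qed
qed

text \<open>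
  A series \<open>f\<close> is expanded along the words \<open>1, a, a\<^sup>2, b, \<dots>, b\<^sup>d\<close>.  Whenever the expansion leaves
  this list, it does so through one of the finitely many words \<open>ab\<close>, \<open>a\<^sup>2b\<close>, \<open>a\<^sup>3\<close>, \<open>b\<^sup>ja\<close>,
  \<open>b\<^sup>d\<^sup>+\<^sup>1\<close>, all of which lie in \<open>I\<close>.  Hence all longer words are absorbed by finitely many elements of \<open>I\<close>,
  although \<open>I\<close> need not be closed under infinite sums.  For \<open>f\<close> in the Gorenstein ideal, the terms
  that remain add up to a multiple of \<open>a\<^sup>2 + b\<^sup>d\<close>.
\<close>

lemma gorenstein_ideal_subset:
  assumes I: "ideal I Cab" and ab: "word [Letter_a, Letter_b] \<in> I"
    and ba: "word [Letter_b, Letter_a] \<in> I"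
    and bd: "word (b_power (Suc d)) \<in> I"
    and rel: "(\<lambda>w. word [Letter_a, Letter_a] w + word (b_power d) w) \<in> I"
    and d: "d \<ge> 2"
  shows "gorenstein_ideal d \<subseteq> I"
proof
  fix f assume f: "f \<in> gorenstein_ideal d"
  \<comment> \<open>The part of \<open>f\<close> supported on the words that begin with \<open>u\<close>.\<close>
  define T where "T u = nc_mult (word u) (left_quotient u f)" for u
  have T: "T u w = f u * word u w + T (u @ [Letter_a]) w + T (u @ [Letter_b]) w" for u w
    unfolding T_def by (rule word_mult_left_quotient)
  have TI: "T u \<in> I" if "word u \<in> I" for u
    unfolding T_def using that by (rule ideal_mult[OF I])
  \<comment> \<open>\<open>a\<^sup>3\<close> is \<open>a (a\<^sup>2 + b\<^sup>d)\<close> minus \<open>ab\<close> times \<open>b\<^sup>d\<^sup>-\<^sup>1\<close>.\<close>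
  have "(\<lambda>w. nc_mult (word [Letter_a]) (\<lambda>w. word [Letter_a, Letter_a] w + word (b_power d) w) w
      - nc_mult (word [Letter_a, Letter_b]) (word (b_power (d - 1))) w) \<in> I"
    by (intro ideal_diff[OF I] ideal_mult[OF I] rel ab)
  also have "(\<lambda>w. nc_mult (word [Letter_a]) (\<lambda>w. word [Letter_a, Letter_a] w + word (b_power d) w) w
      - nc_mult (word [Letter_a, Letter_b]) (word (b_power (d - 1))) w)
     = word [Letter_a, Letter_a, Letter_a]"
    using d by (cases d) (simp_all add: nc_mult_add_right word_mult_word)
  finally have aaa: "word [Letter_a, Letter_a, Letter_a] \<in> I" .
  have aab: "word [Letter_a, Letter_a, Letter_b] \<in> I"
    using ideal_word[OF I ab, of "[Letter_a]" "[]"] by simp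
  have b_part: "(\<lambda>w. T [Letter_b] w - T (b_power j) w) \<in> I" if "1 \<le> j" "j \<le> d" for j
    using that
  proof (induction j rule: dec_induct)
    case base
    \<comment> \<open>Any element of \<open>I\<close> minus itself is zero.\<close>
    show ?case using ideal_diff[OF I bd bd] by simp
  next
    case (step j)
    have "b_power j @ [Letter_a] = b_power (j - 1) @ [Letter_b, Letter_a] @ []"
      using step by (cases j) (auto simp: replicate_append_same)
    then have a: "T (b_power j @ [Letter_a]) \<in> I"
      using TI ideal_word[OF I ba] by metis
    have "f (b_power j) = 0" using f step by (simp add: gorenstein_ideal_def)
    then have "T (b_power j) w = T (b_power j @ [Letter_a]) w + T (b_power (Suc j)) w" for w
      using T[of "b_power j" w] by (simp add: replicate_append_same)
    then have "(\<lambda>w. T [Letter_b] w - T (b_power (Suc j)) w)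
        = (\<lambda>w. (T [Letter_b] w - T (b_power j) w) + T (b_power j @ [Letter_a]) w)"
      by (simp add: fun_eq_iff)
    then show ?case using ideal_add[OF I _ a] step by simp
  qed
  have "b_power d @ [Letter_a] = b_power (d - 1) @ [Letter_b, Letter_a] @ []"
      using d by (cases d) (auto simp: replicate_append_same)
  then have bda: "T (b_power d @ [Letter_a]) \<in> I"
    using TI ideal_word[OF I ba] by metis
  have bdb: "T (b_power d @ [Letter_b]) \<in> I"
    using TI bd by (simp add: replicate_append_same)
  have f_T: "f w = T [] w" for w
    by (simp add: T_def word_mult left_quotient_def)
  have f0: "f [] = 0" "f [Letter_a] = 0" "f (b_power d) = f [Letter_a, Letter_a]"
    using f d by (force simp: gorenstein_ideal_def)+
  have "f = (\<lambda>w. f [Letter_a, Letter_a] * (word [Letter_a, Letter_a] w + word (b_power d) w)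
      + (T [Letter_a, Letter_a, Letter_a] w + (T [Letter_a, Letter_a, Letter_b] w
      + (T [Letter_a, Letter_b] w + ((T [Letter_b] w - T (b_power d) w)
      + (T (b_power d @ [Letter_a]) w + T (b_power d @ [Letter_b]) w))))))"
  proof
    fix w
    have "f w = T [Letter_a] w + T [Letter_b] w"
      using f_T[of w] T[of "[]" w] f0(1) by simp
    moreover have "T [Letter_a] w = T [Letter_a, Letter_a] w + T [Letter_a, Letter_b] w"
      using T[of "[Letter_a]" w] f0(2) by simp
    moreover have "T [Letter_a, Letter_a] w = f [Letter_a, Letter_a] * word [Letter_a, Letter_a] w
        + T [Letter_a, Letter_a, Letter_a] w + T [Letter_a, Letter_a, Letter_b] w"
      using T[of "[Letter_a, Letter_a]" w] by simp
    moreover have "T (b_power d) w = f [Letter_a, Letter_a] * word (b_power d) w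
        + T (b_power d @ [Letter_a]) w + T (b_power d @ [Letter_b]) w"
      unfolding f0(3)[symmetric] by (rule T)
    ultimately show "f w = f [Letter_a, Letter_a] * (word [Letter_a, Letter_a] w + word (b_power d) w)
      + (T [Letter_a, Letter_a, Letter_a] w + (T [Letter_a, Letter_a, Letter_b] w
      + (T [Letter_a, Letter_b] w + ((T [Letter_b] w - T (b_power d) w)
      + (T (b_power d @ [Letter_a]) w + T (b_power d @ [Letter_b]) w)))))"
      by (simp add: distrib_left)
  qed
  also have "\<dots> \<in> I"
    by (intro ideal_add[OF I] ideal_scale[OF I] rel TI aaa aab ab bda bdb b_part) (use d in auto)
  finally show "f \<in> I" .
qed

lemma genideal_relations_commutators:
  assumes n: "n > 0"
  shows "genideal Cab (relations n i \<union> commutators Cab) = gorenstein_ideal (socle_degree n i)"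
proof
  have d: "socle_degree n i \<ge> 2" using n by (auto simp: socle_degree_def)
  then show "genideal Cab (relations n i \<union> commutators Cab) \<subseteq> gorenstein_ideal (socle_degree n i)"
    using relations_subset_gorenstein_ideal[OF n] commutators_subset_gorenstein_ideal
    by (intro NCPS.genideal_minimal ideal_gorenstein_ideal) auto
  let ?I = "genideal Cab (relations n i \<union> commutators Cab)"
  have I: "ideal ?I Cab" by (rule NCPS.genideal_ideal) (simp add: NCPS_simps)
  have "relations n i \<union> commutators Cab \<subseteq> ?I"
    by (rule NCPS.genideal_self) (simp add: NCPS_simps)
  then show "gorenstein_ideal (socle_degree n i) \<subseteq> ?I"
    by (intro gorenstein_ideal_subset[OF I] relations_in_standard_form[OF I _ _ n] d) auto
qed


section \<open>The abelianizations\<close>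

text \<open>
  Some power of \<open>f\<close> lies in the ideal only if the constant term of \<open>f\<close> vanishes; then \<open>f\<^sup>k\<close> has no
  words shorter than \<open>k\<close>, and for \<open>k > d\<close> this puts it into the ideal.  The bound is attained by
  \<open>f = b\<close>.
\<close>

lemma power_in_gorenstein_ideal_iff:
  assumes d: "d \<ge> 2"
  shows "(\<exists>f. f [^]\<^bsub>Cab\<^esub> k \<notin> gorenstein_ideal d \<and> (\<exists>m::nat. f [^]\<^bsub>Cab\<^esub> m \<in> gorenstein_ideal d)) \<longleftrightarrow> k \<le> d"
proof
  assume "k \<le> d"
  have [simp]: "(b_power j = b_power k) = (j = k)" for j k by (metis length_replicate)
  have [simp]: "b_power j \<noteq> Letter_a # w" "Letter_a # w \<noteq> b_power j" for j w
    by (cases j; auto)+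
  have "word [Letter_b] [^]\<^bsub>Cab\<^esub> k \<notin> gorenstein_ideal d"
    unfolding word_power
    using \<open>k \<le> d\<close> by (cases "k = d") (auto simp: gorenstein_ideal_def word_def)
  moreover have "word [Letter_b] [^]\<^bsub>Cab\<^esub> Suc d \<in> gorenstein_ideal d"
    unfolding word_power by (auto simp: gorenstein_ideal_def word_def simp del: replicate_Suc)
  ultimately show "\<exists>f. f [^]\<^bsub>Cab\<^esub> k \<notin> gorenstein_ideal d \<and> (\<exists>m::nat. f [^]\<^bsub>Cab\<^esub> m \<in> gorenstein_ideal d)" by blast
next
  assume "\<exists>f. f [^]\<^bsub>Cab\<^esub> k \<notin> gorenstein_ideal d \<and> (\<exists>m::nat. f [^]\<^bsub>Cab\<^esub> m \<in> gorenstein_ideal d)"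
  then obtain f and m :: nat where f: "f [^]\<^bsub>Cab\<^esub> k \<notin> gorenstein_ideal d" "f [^]\<^bsub>Cab\<^esub> m \<in> gorenstein_ideal d"
    by blast
  have "(f [^]\<^bsub>Cab\<^esub> m) (b_power 0) = 0" using f(2) d unfolding gorenstein_ideal_def by force
  then have "f [] = 0" by (simp add: power_Nil)
  then have "f [^]\<^bsub>Cab\<^esub> k \<in> gorenstein_ideal d" if "d < k"
    using that d by (simp add: gorenstein_ideal_def power_eq_0_if_short)
  then show "k \<le> d" using f(1) by force
qed

lemma abelianization_A:
  assumes n: "n > 0"
  obtains h where "alg_epimorphism Cab (abelianization (A n i)) h"
    and "a_kernel Cab (abelianization (A n i)) h = gorenstein_ideal (socle_degree n i)"
  using NCPS.abelianization_of_quotient[of "relations n i"]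
  unfolding genideal_relations_commutators[OF n] A_def[symmetric] by (auto simp: NCPS_simps)

lemma ring_abelianization_A:
  assumes n: "n > 0"
  shows "ring (abelianization (A n i))"
  using abelianization_A[OF n] by (metis alg_epimorphism_def unital_algebra_def)

lemma nilpotent_orders_abelianization_A:
  assumes n: "n > 0"
  shows "nilpotent_orders (abelianization (A n i)) = {..socle_degree n i}"
proof -
  obtain h where h: "alg_epimorphism Cab (abelianization (A n i)) h"
    and ker: "a_kernel Cab (abelianization (A n i)) h = gorenstein_ideal (socle_degree n i)"
    by (rule abelianization_A[OF n])
  have "socle_degree n i \<ge> 2" using n by (auto simp: socle_degree_def)
  then show ?thesis
    unfolding alg_epimorphism.nilpotent_orders_image[OF h] ker
    using power_in_gorenstein_ideal_iff by (auto simp: NCPS_simps)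
qed

theorem proposition5p9:
  fixes n :: nat
  assumes "n > 0"
  shows "(\<forall>i\<in>{0..n}. \<forall>j\<in>{0..n}. i \<noteq> j \<longrightarrow>
            \<not> alg_isomorphic (abelianization (A n i)) (abelianization (A n j))) \<and>
         (\<forall>i\<in>{0} \<union> {n+1..2*n}. \<forall>j\<in>{0} \<union> {n+1..2*n}.
            alg_isomorphic (abelianization (A n i)) (abelianization (A n j)))"
proof (intro conjI ballI impI notI)
  fix i j assume ij: "i \<in> {0..n}" "j \<in> {0..n}" "i \<noteq> j"
    and "alg_isomorphic (abelianization (A n i)) (abelianization (A n j))"
  then have "{..socle_degree n i} = {..socle_degree n j}"
    using nilpotent_orders_eq ring_abelianization_A[OF assms]
    by (metis nilpotent_orders_abelianization_A[OF assms])
  then have "socle_degree n i = socle_degree n j" by simp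
  with ij show False by (auto simp: socle_degree_def split: if_splits) presburger+
next
  fix i j assume ij: "i \<in> {0} \<union> {n+1..2*n}" "j \<in> {0} \<union> {n+1..2*n}"
  obtain g where g: "alg_epimorphism Cab (abelianization (A n i)) g"
      "a_kernel Cab (abelianization (A n i)) g = gorenstein_ideal (socle_degree n i)"
    by (rule abelianization_A[OF assms])
  obtain h where h: "alg_epimorphism Cab (abelianization (A n j)) h"
      "a_kernel Cab (abelianization (A n j)) h = gorenstein_ideal (socle_degree n j)"
    by (rule abelianization_A[OF assms])
  have "socle_degree n i = socle_degree n j" using ij by (auto simp: socle_degree_def)
  then show "alg_isomorphic (abelianization (A n i)) (abelianization (A n j))"
    using g h by (intro alg_isomorphic_if_same_kernel[OF g(1) h(1)]) simp
qed

end
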